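(* Let $A=M+K$ be $n\times n$ real matrices with $A$ and $M$ invertible, let $b\in\mathbb{R}^n$, $b\ne0$, and let $x=A^{-1}b$. Put $B:=I+M^{-1}K$ and $c:=M^{-1}b$. Consider solving $Bx=c$ by an iterative method where the matrix-vector product $Bv=v+M^{-1}Kv$ is computed by an inverse-equivalent algorithm for inverting $M$. Assume that the iterative method produces an approximate solution $x_L$ with $$\|c-Bx_L\|\le\mathcal{O}(\mathbf{u})\,(1+\|M^{-1}\|\|K\|)\,\|x_L\|\quad\text{and}\quad\|b-Ax_L\|\le\|b\|.$$ Then $$\frac{\|x-x_L\|}{\|A^{-1}\|\|b\|}\le\mathcal{O}(\mathbf{u})\,\kappa(B)\left(1+\frac{\|K\|\|x_L\|}{\|b\|}\right)\le\mathcal{O}(\mathbf{u})\,\kappa(B)\left(1+2\|A^{-1}\|\|K\|\right).$$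
   Context: Norms: $\|\cdot\|$ denotes a general norm for vectors on $\mathbb{R}^n$ and its induced operator norm for matrices; $\kappa(B)=\|B\|\|B^{-1}\|$. Order notation: $\mathbf{u}$ ($0<\mathbf{u}<1$) is the machine roundoff unit, and $\mathcal{O}(\mathbf{u})$ denotes a term bounded by $p(n)\mathbf{u}$ for some polynomial $p(n)$ in $n$. Different occurrences may involve different polynomials; the polynomials in the conclusion depend only on those in the hypotheses, not on the particular matrices and vectors. Definition: given an invertible $M$, an algorithm for solving linear systems with coefficient matrix $M$ is inverse-equivalent if, for any right-hand side $d$, it produces in floating point arithmetic a computed solution $\hat y$ to $My=d$ such that $\|\hat y-y\|\le\mathcal{O}(\mathbf{u})\|M^{-1}\|\|d\|$, where $y=M^{-1}d$. In the theorem the algorithm and the iterative method enter only through the two stated residual bounds on $x_L$. *)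

theory Defs
  imports
    "Jordan_Normal_Form.Gauss_Jordan_Elimination"
    "HOL-Computational_Algebra.Polynomial"
begin

text \<open>
  Vectors and matrices are the explicitly dimensioned ones, with carriers
  \<^term>\<open>carrier_vec n\<close> and \<^term>\<open>carrier_mat n n\<close>: the polynomials hidden in the
  order notation have to be chosen before the dimension \<^term>\<open>n\<close>, so \<^term>\<open>n\<close> must be
  an ordinary number and not a type.
\<close>

definition is_vec_norm :: "nat \<Rightarrow> (real vec \<Rightarrow> real) \<Rightarrow> bool" where
  "is_vec_norm n N \<longleftrightarrow>
     (\<forall>v \<in> carrier_vec n. 0 \<le> N v) \<and>
     (\<forall>v \<in> carrier_vec n. N v = 0 \<longleftrightarrow> v = 0\<^sub>v n) \<and>
     (\<forall>a. \<forall>v \<in> carrier_vec n. N (a \<cdot>\<^sub>v v) = \<bar>a\<bar> * N v) \<and>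
     (\<forall>v \<in> carrier_vec n. \<forall>w \<in> carrier_vec n. N (v + w) \<le> N v + N w)"

text \<open>
  The induced operator norm, written as in the library definition of \<open>onorm\<close>. The zero
  vector contributes \<open>0 / 0 = 0\<close>, which does not change the supremum. For a norm \<^term>\<open>N\<close>
  on \<^term>\<open>carrier_vec n\<close> the quotients are bounded above because the dimension is finite.
\<close>

definition op_norm :: "nat \<Rightarrow> (real vec \<Rightarrow> real) \<Rightarrow> real mat \<Rightarrow> real" where
  "op_norm n N A = (SUP v \<in> carrier_vec n. N (A *\<^sub>v v) / N v)"

text \<open>
  The library function \<^term>\<open>mat_inverse\<close> is option-valued; the value of \<open>mat_inv\<close> is
  meaningful only for invertible arguments.
\<close>

definition mat_inv :: "real mat \<Rightarrow> real mat" where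
  "mat_inv A = the (mat_inverse A)"

lemma mat_inv:
  assumes A: "A \<in> carrier_mat n n" and inv: "invertible_mat A"
  shows "mat_inv A \<in> carrier_mat n n"
    and "A * mat_inv A = 1\<^sub>m n"
    and "mat_inv A * A = 1\<^sub>m n"
proof -
  from inv obtain B where AB: "A * B = 1\<^sub>m n" and BA: "B * A = 1\<^sub>m (dim_row B)"
    using A unfolding invertible_mat_def inverts_mat_def by auto
  have "dim_col B = n" using arg_cong[OF AB, of dim_col] by simp
  moreover have "dim_row B = n" using arg_cong[OF BA, of dim_col] A by simp
  ultimately have B: "B \<in> carrier_mat n n" by auto
  then have "A \<in> Units (ring_mat TYPE(real) n ())"
    using A AB BA unfolding Units_def ring_mat_def by auto
  then obtain C where C: "mat_inverse A = Some C"
    using mat_inverse(1)[OF A, of "()"] by fastforce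
  then show "mat_inv A \<in> carrier_mat n n" "A * mat_inv A = 1\<^sub>m n" "mat_inv A * A = 1\<^sub>m n"
    using mat_inverse(2)[OF A C] unfolding mat_inv_def by auto
qed

definition cond_num :: "nat \<Rightarrow> (real vec \<Rightarrow> real) \<Rightarrow> real mat \<Rightarrow> real" where
  "cond_num n N B = op_norm n N B * op_norm n N (mat_inv B)"

end

theory Submission
  imports Defs "HOL-Analysis.Function_Topology"
begin

text \<open>
  Since \<open>A = M B\<close>, the error equation is \<open>x - x\<^sub>L = B\<inverse> (c - B x\<^sub>L)\<close>, so the first residual
  bound gives
  \<open>\<parallel>x - x\<^sub>L\<parallel> \<le> p u \<parallel>B\<inverse>\<parallel> (1 + \<parallel>M\<inverse>\<parallel> \<parallel>K\<parallel>) \<parallel>x\<^sub>L\<parallel>\<close>. The task is to replace the factor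
  \<open>(1 + \<parallel>M\<inverse>\<parallel> \<parallel>K\<parallel>) \<parallel>x\<^sub>L\<parallel>\<close>, in which \<open>M\<close> may be badly conditioned, by a multiple of \<open>\<parallel>B\<parallel>\<close>.
  This works because \<open>M\<inverse> = B A\<inverse>\<close>, hence \<open>\<parallel>M\<inverse>\<parallel> \<le> \<parallel>B\<parallel> \<parallel>A\<inverse>\<parallel>\<close>. It handles the product
  \<open>\<parallel>M\<inverse>\<parallel> \<parallel>K\<parallel>\<close> directly, and it also handles the summand \<open>1\<close>: the identity is
  \<open>B - M\<inverse> K\<close>, so \<open>1 \<le> \<parallel>B\<parallel> (1 + \<parallel>A\<inverse>\<parallel> \<parallel>K\<parallel>)\<close>, although \<open>\<parallel>B\<parallel>\<close> itself may be tiny. Finally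
  the second residual bound yields \<open>\<parallel>x\<^sub>L\<parallel> \<le> 2 \<parallel>A\<inverse>\<parallel> \<parallel>b\<parallel>\<close>. Altogether the factor
  \<open>2 \<bar>p\<bar>\<close> suffices in both inequalities; as \<open>p\<close> may take negative values, this is not a
  polynomial, but it is dominated by the polynomial \<open>p\<^sup>2 + 1\<close>.

  All of this rests on \<open>\<parallel>A v\<parallel> \<le> \<parallel>A\<parallel> \<parallel>v\<parallel>\<close>, which for a supremum of reals requires the
  quotients \<open>\<parallel>A v\<parallel> / \<parallel>v\<parallel>\<close> to be bounded. For an arbitrary norm this is the equivalence of
  norms in finite dimension, obtained here from the compactness of the faces of a cube.
\<close>

section \<open>Equivalence of norms in finite dimension\<close>

lemma is_vec_normD:
  assumes "is_vec_norm n N"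
  shows is_vec_norm_nonneg: "v \<in> carrier_vec n \<Longrightarrow> 0 \<le> N v"
    and is_vec_norm_eq_0_iff: "v \<in> carrier_vec n \<Longrightarrow> N v = 0 \<longleftrightarrow> v = 0\<^sub>v n"
    and is_vec_norm_smult: "v \<in> carrier_vec n \<Longrightarrow> N (a \<cdot>\<^sub>v v) = \<bar>a\<bar> * N v"
    and is_vec_norm_triangle:
      "v \<in> carrier_vec n \<Longrightarrow> w \<in> carrier_vec n \<Longrightarrow> N (v + w) \<le> N v + N w"
  using assms by (simp_all add: is_vec_norm_def)

lemma is_vec_norm_minus_commute:
  assumes N: "is_vec_norm n N" and "v \<in> carrier_vec n" "w \<in> carrier_vec n"
  shows "N (v - w) = N (w - v)"
proof -
  have "w - v = (-1) \<cdot>\<^sub>v (v - w)"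
    using assms by (intro eq_vecI) auto
  then show ?thesis
    using assms is_vec_norm_smult[OF N, of "v - w" "-1"] by simp
qed

text \<open>
  Stated for seminorm-like functions so that it applies both to a norm \<open>N\<close> and to the map
  \<open>v \<mapsto> N (A v)\<close>.
\<close>

lemma sublinear_le_sum_unit_vec:
  fixes f :: "real vec \<Rightarrow> real"
  assumes hom: "\<And>a v. v \<in> carrier_vec n \<Longrightarrow> f (a \<cdot>\<^sub>v v) = \<bar>a\<bar> * f v"
    and tri: "\<And>v w. v \<in> carrier_vec n \<Longrightarrow> w \<in> carrier_vec n \<Longrightarrow> f (v + w) \<le> f v + f w"
    and v: "v \<in> carrier_vec n"
  shows "f v \<le> (\<Sum>i<n. \<bar>v $ i\<bar> * f (unit_vec n i))"
proof -
  define t where "t k = vec n (\<lambda>i. if i < k then v $ i else 0)" for k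
  have t: "t k \<in> carrier_vec n" for k
    by (simp add: t_def)
  have "f (t k) \<le> (\<Sum>i<k. \<bar>v $ i\<bar> * f (unit_vec n i))" if "k \<le> n" for k
    using that
  proof (induction k)
    case 0
    have "t 0 = 0 \<cdot>\<^sub>v t 0"
      by (intro eq_vecI) (auto simp: t_def)
    then have "f (t 0) = 0"
      using hom[OF t, of 0 0] by simp
    then show ?case by simp
  next
    case (Suc k)
    have "t (Suc k) = t k + (v $ k) \<cdot>\<^sub>v unit_vec n k"
      using Suc.prems by (intro eq_vecI) (auto simp: t_def unit_vec_def less_Suc_eq)
    then have "f (t (Suc k)) \<le> f (t k) + f ((v $ k) \<cdot>\<^sub>v unit_vec n k)"
      using tri[OF t, of "(v $ k) \<cdot>\<^sub>v unit_vec n k"] by simp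
    then show ?case
      using Suc hom[of "unit_vec n k" "v $ k"] by simp
  qed
  from this[of n] have "f (t n) \<le> (\<Sum>i<n. \<bar>v $ i\<bar> * f (unit_vec n i))"
    by simp
  moreover have "t n = v"
    using v by (intro eq_vecI) (auto simp: t_def)
  ultimately show ?thesis by simp
qed

lemma is_vec_norm_le_sum_unit_vec:
  assumes N: "is_vec_norm n N" and v: "v \<in> carrier_vec n"
  shows "N v \<le> (\<Sum>i<n. \<bar>v $ i\<bar> * N (unit_vec n i))"
  using sublinear_le_sum_unit_vec[of n N v] is_vec_norm_smult[OF N] is_vec_norm_triangle[OF N] v
  by blast

text \<open>
  The coordinates of a vector are read from a function \<^typ>\<open>nat \<Rightarrow> real\<close>, whose type carries
  the product topology; this makes Tychonoff's theorem available.
\<close>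

lemma continuous_on_is_vec_norm:
  assumes N: "is_vec_norm n N"
  shows "continuous_on S (\<lambda>y. N (vec n y))"
proof -
  have bound: "\<bar>N (vec n y) - N (vec n z)\<bar> \<le> (\<Sum>i<n. \<bar>y i - z i\<bar> * N (unit_vec n i))" for y z
  proof -
    let ?y = "vec n y" and ?z = "vec n z"
    have "?z + (?y - ?z) = ?y" "?y + (?z - ?y) = ?z"
      by (intro eq_vecI; simp)+
    then have "N ?y \<le> N ?z + N (?y - ?z)" "N ?z \<le> N ?y + N (?z - ?y)"
      using is_vec_norm_triangle[OF N, of ?z "?y - ?z"] is_vec_norm_triangle[OF N, of ?y "?z - ?y"]
      by simp_all
    then have "\<bar>N ?y - N ?z\<bar> \<le> N (?y - ?z)"
      using is_vec_norm_minus_commute[OF N, of ?y ?z] by simp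
    also have "\<dots> \<le> (\<Sum>i<n. \<bar>(?y - ?z) $ i\<bar> * N (unit_vec n i))"
      by (rule is_vec_norm_le_sum_unit_vec[OF N]) simp
    finally show ?thesis by simp
  qed
  show ?thesis
    unfolding continuous_on_def
  proof
    fix z :: "nat \<Rightarrow> real" assume "z \<in> S"
    have coord: "((\<lambda>y. y i) \<longlongrightarrow> z i) (at z within S)" for i
      using continuous_on_subset[OF continuous_on_product_coordinates[of i] subset_UNIV, of S]
        \<open>z \<in> S\<close>
      by (auto simp: continuous_on_def)
    have "((\<lambda>y. \<Sum>i<n. \<bar>y i - z i\<bar> * N (unit_vec n i)) \<longlongrightarrow> (\<Sum>i<n. \<bar>z i - z i\<bar> * N (unit_vec n i)))
        (at z within S)"
      by (intro tendsto_intros coord)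
    then have "((\<lambda>y. \<Sum>i<n. \<bar>y i - z i\<bar> * N (unit_vec n i)) \<longlongrightarrow> 0) (at z within S)"
      by simp
    then have "((\<lambda>y. N (vec n y) - N (vec n z)) \<longlongrightarrow> 0) (at z within S)"
      by (rule tendsto_0_le[where K = 1])
        (use bound order_trans[OF bound abs_ge_self] in \<open>auto intro!: always_eventually\<close>)
    then show "((\<lambda>y. N (vec n y)) \<longlongrightarrow> N (vec n z)) (at z within S)"
      by (simp add: LIM_zero_iff)
  qed
qed

text \<open>
  On the face \<open>y\<^sub>k = 1\<close> of the unit cube, a compact set that misses the origin, the norm has a
  positive minimum. Dividing by a coordinate of largest absolute value moves any vector onto
  such a face.
\<close>

lemma is_vec_norm_face_bound:
  assumes N: "is_vec_norm n N" and k: "k < n"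
  obtains m where "0 < m"
    and "\<And>v. v \<in> carrier_vec n \<Longrightarrow> \<forall>i<n. \<bar>v $ i\<bar> \<le> \<bar>v $ k\<bar> \<Longrightarrow> m * \<bar>v $ k\<bar> \<le> N v"
proof -
  define F where "F = (\<Pi>\<^sub>E i\<in>UNIV. if i = k then {1} else {-1..1::real})"
  have "compactin (product_topology (\<lambda>_. euclidean) UNIV) F"
    unfolding F_def by (subst compactin_PiE) auto
  then have "compact F"
    by (simp add: euclidean_product_topology)
  moreover have "(\<lambda>_. 1) \<in> F"
    by (auto simp: F_def)
  then have "F \<noteq> {}" by blast
  ultimately obtain z where z: "z \<in> F" and min: "\<And>y. y \<in> F \<Longrightarrow> N (vec n z) \<le> N (vec n y)"
    using continuous_attains_inf[of F "\<lambda>y. N (vec n y)"] continuous_on_is_vec_norm[OF N] by blast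
  have "z k = 1"
    using z by (auto simp: F_def PiE_iff dest: spec[of _ k])
  then have "vec n z \<noteq> 0\<^sub>v n"
    using k by (metis index_vec index_zero_vec(1) zero_neq_one)
  then have pos: "0 < N (vec n z)"
    using is_vec_norm_nonneg[OF N, of "vec n z"] is_vec_norm_eq_0_iff[OF N, of "vec n z"]
    by (simp add: less_le)
  have "N (vec n z) * \<bar>v $ k\<bar> \<le> N v"
    if v: "v \<in> carrier_vec n" and max: "\<forall>i<n. \<bar>v $ i\<bar> \<le> \<bar>v $ k\<bar>" for v
  proof (cases "v $ k = 0")
    case True
    then show ?thesis using is_vec_norm_nonneg[OF N v] by simp
  next
    case False
    \<comment> \<open>Outside the range of indices of \<open>v\<close> any value in \<open>[-1, 1]\<close> would do.\<close>
    define y where "y i = (if i < n then v $ i / v $ k else 0)" for i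
    have "\<bar>y i\<bar> \<le> 1" for i
      using max False by (simp add: y_def divide_le_eq_1)
    then have "y i \<in> {-1..1}" for i
      by (metis abs_le_iff atLeastAtMost_iff minus_le_iff)
    moreover have "y k = 1"
      using False k by (simp add: y_def)
    ultimately have "y \<in> F"
      by (simp add: F_def PiE_iff)
    moreover have "v = (v $ k) \<cdot>\<^sub>v vec n y"
      using v False by (intro eq_vecI) (auto simp: y_def)
    then have "N v = \<bar>v $ k\<bar> * N (vec n y)"
      using is_vec_norm_smult[OF N, of "vec n y" "v $ k"] by simp
    ultimately show ?thesis
      using min[of y] by (simp add: mult.commute mult_left_mono)
  qed
  with pos show thesis by (rule that)
qed

lemma is_vec_norm_coordinate_bound:
  assumes N: "is_vec_norm n N"
  obtains C where "0 \<le> C" and "\<And>v i. v \<in> carrier_vec n \<Longrightarrow> i < n \<Longrightarrow> \<bar>v $ i\<bar> \<le> C * N v"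
proof -
  have "\<forall>k<n. \<exists>m>0. \<forall>v \<in> carrier_vec n. (\<forall>i<n. \<bar>v $ i\<bar> \<le> \<bar>v $ k\<bar>) \<longrightarrow> m * \<bar>v $ k\<bar> \<le> N v"
    using is_vec_norm_face_bound[OF N] by metis
  then obtain m where pos: "\<And>k. k < n \<Longrightarrow> 0 < m k"
    and m: "\<And>k v. k < n \<Longrightarrow> v \<in> carrier_vec n \<Longrightarrow> \<forall>i<n. \<bar>v $ i\<bar> \<le> \<bar>v $ k\<bar> \<Longrightarrow> m k * \<bar>v $ k\<bar> \<le> N v"
    by metis
  define C where "C = (\<Sum>k<n. 1 / m k)"
  have "\<bar>v $ i\<bar> \<le> C * N v" if v: "v \<in> carrier_vec n" and i: "i < n" for v i
  proof -
    obtain k where k: "k < n" and max: "\<forall>i<n. \<bar>v $ i\<bar> \<le> \<bar>v $ k\<bar>"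
      using ex_is_arg_min_if_finite[of "{..<n}" "\<lambda>i. - \<bar>v $ i\<bar>"] i
      by (auto simp: is_arg_min_linorder)
    have "\<bar>v $ i\<bar> \<le> \<bar>v $ k\<bar>" using max i by blast
    also have "\<dots> \<le> 1 / m k * N v"
      using m[OF k v max] pos[OF k] by (simp add: pos_le_divide_eq mult.commute)
    also have "1 / m k \<le> C"
      unfolding C_def using pos k by (intro member_le_sum) (auto intro: less_imp_le)
    then have "1 / m k * N v \<le> C * N v"
      using is_vec_norm_nonneg[OF N v] by (rule mult_right_mono)
    finally show ?thesis .
  qed
  moreover have "0 \<le> C"
    unfolding C_def using pos by (intro sum_nonneg) (auto intro: less_imp_le)
  ultimately show thesis by (intro that)
qed

section \<open>The induced operator norm\<close>

lemma bdd_above_op_norm_quotients: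
  assumes N: "is_vec_norm n N" and A: "A \<in> carrier_mat n n"
  shows "bdd_above ((\<lambda>v. N (A *\<^sub>v v) / N v) ` carrier_vec n)"
proof -
  obtain C where C: "0 \<le> C" "\<And>v i. v \<in> carrier_vec n \<Longrightarrow> i < n \<Longrightarrow> \<bar>v $ i\<bar> \<le> C * N v"
    using is_vec_norm_coordinate_bound[OF N] by blast
  define D where "D = (\<Sum>i<n. C * N (A *\<^sub>v unit_vec n i))"
  have Ae: "0 \<le> N (A *\<^sub>v unit_vec n i)" for i
    using A by (intro is_vec_norm_nonneg[OF N]) simp
  have D: "0 \<le> D"
    unfolding D_def using C(1) Ae by (intro sum_nonneg) simp
  have "N (A *\<^sub>v v) / N v \<le> D" if v: "v \<in> carrier_vec n" for v
  proof (cases "v = 0\<^sub>v n")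
    case True
    then have "N v = 0" using is_vec_norm_eq_0_iff[OF N v] by simp
    then show ?thesis using D by simp
  next
    case False
    then have Nv: "0 < N v"
      using is_vec_norm_nonneg[OF N v] is_vec_norm_eq_0_iff[OF N v] by simp
    have "N (A *\<^sub>v v) \<le> (\<Sum>i<n. \<bar>v $ i\<bar> * N (A *\<^sub>v unit_vec n i))"
    proof (rule sublinear_le_sum_unit_vec[where f = "\<lambda>v. N (A *\<^sub>v v)", OF _ _ v])
      show "N (A *\<^sub>v (a \<cdot>\<^sub>v w)) = \<bar>a\<bar> * N (A *\<^sub>v w)" if "w \<in> carrier_vec n" for a w
        using A that is_vec_norm_smult[OF N, of "A *\<^sub>v w" a] by (simp add: mult_mat_vec[OF A that])
      show "N (A *\<^sub>v (w + w')) \<le> N (A *\<^sub>v w) + N (A *\<^sub>v w')"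
        if "w \<in> carrier_vec n" "w' \<in> carrier_vec n" for w w'
        using A that is_vec_norm_triangle[OF N, of "A *\<^sub>v w" "A *\<^sub>v w'"]
        by (simp add: mult_add_distrib_mat_vec[OF A that])
    qed
    also have "\<dots> \<le> (\<Sum>i<n. (C * N v) * N (A *\<^sub>v unit_vec n i))"
      using C(2)[OF v] Ae by (intro sum_mono mult_right_mono) auto
    also have "\<dots> = D * N v"
      unfolding D_def sum_distrib_right by (intro sum.cong) auto
    finally show ?thesis using Nv by (simp add: pos_divide_le_eq)
  qed
  then show ?thesis by (intro bdd_aboveI2)
qed

lemma op_norm_nonneg:
  assumes N: "is_vec_norm n N" and A: "A \<in> carrier_mat n n"
  shows "0 \<le> op_norm n N A"
proof -
  \<comment> \<open>The zero vector contributes the value \<open>0 / 0 = 0\<close> to the supremum.\<close>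
  have "N (A *\<^sub>v 0\<^sub>v n) / N (0\<^sub>v n) \<le> op_norm n N A"
    unfolding op_norm_def by (intro cSUP_upper bdd_above_op_norm_quotients[OF N A]) simp
  moreover have "N (0\<^sub>v n) = 0"
    using is_vec_norm_eq_0_iff[OF N] by simp
  ultimately show ?thesis by simp
qed

lemma norm_mult_mat_vec_le:
  assumes N: "is_vec_norm n N" and A: "A \<in> carrier_mat n n" and v: "v \<in> carrier_vec n"
  shows "N (A *\<^sub>v v) \<le> op_norm n N A * N v"
proof (cases "v = 0\<^sub>v n")
  case True
  have "A *\<^sub>v 0\<^sub>v n = 0\<^sub>v n"
    using A by (intro eq_vecI) auto
  then show ?thesis
    using True is_vec_norm_eq_0_iff[OF N, of "0\<^sub>v n"] by simp
next
  case False
  then have "0 < N v"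
    using is_vec_norm_nonneg[OF N v] is_vec_norm_eq_0_iff[OF N v] by simp
  moreover have "N (A *\<^sub>v v) / N v \<le> op_norm n N A"
    unfolding op_norm_def by (intro cSUP_upper bdd_above_op_norm_quotients[OF N A] v)
  ultimately show ?thesis by (simp add: pos_divide_le_eq)
qed

lemma op_norm_le:
  assumes N: "is_vec_norm n N" and k: "0 \<le> k"
    and bound: "\<And>v. v \<in> carrier_vec n \<Longrightarrow> N (A *\<^sub>v v) \<le> k * N v"
  shows "op_norm n N A \<le> k"
  unfolding op_norm_def
proof (rule cSUP_least)
  show "carrier_vec n \<noteq> ({} :: real vec set)"
    using zero_carrier_vec by blast
  show "N (A *\<^sub>v v) / N v \<le> k" if v: "v \<in> carrier_vec n" for v
    using bound[OF v] is_vec_norm_nonneg[OF N v] k by (cases "N v = 0") (auto simp: pos_divide_le_eq)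
qed

lemma op_norm_mult_le:
  assumes N: "is_vec_norm n N" and A: "A \<in> carrier_mat n n" and B: "B \<in> carrier_mat n n"
  shows "op_norm n N (A * B) \<le> op_norm n N A * op_norm n N B"
proof (rule op_norm_le[OF N])
  show "0 \<le> op_norm n N A * op_norm n N B"
    using op_norm_nonneg[OF N] A B by simp
  show "N (A * B *\<^sub>v v) \<le> op_norm n N A * op_norm n N B * N v" if v: "v \<in> carrier_vec n" for v
  proof -
    have "N (A * B *\<^sub>v v) = N (A *\<^sub>v (B *\<^sub>v v))"
      using A B v by (simp add: assoc_mult_mat_vec)
    also have "\<dots> \<le> op_norm n N A * N (B *\<^sub>v v)"
      using B v by (intro norm_mult_mat_vec_le[OF N A]) simp
    also have "\<dots> \<le> op_norm n N A * (op_norm n N B * N v)"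
      by (intro mult_left_mono norm_mult_mat_vec_le[OF N B v] op_norm_nonneg[OF N A])
    finally show ?thesis by (simp add: mult.assoc)
  qed
qed

section \<open>The preconditioned system\<close>

lemma preconditioned_matrix:
  fixes M K :: "real mat"
  assumes M: "M \<in> carrier_mat n n" and K: "K \<in> carrier_mat n n"
    and invA: "invertible_mat (M + K)" and invM: "invertible_mat M"
  defines "A \<equiv> M + K" and "B \<equiv> 1\<^sub>m n + mat_inv M * K"
  shows preconditioned_carrier: "B \<in> carrier_mat n n"
    and preconditioned_eq: "B = mat_inv M * A"
    and preconditioned_invertible: "invertible_mat B"
    and preconditioned_mult_inv: "mat_inv M = B * mat_inv A"
proof -
  have A: "A \<in> carrier_mat n n" using M K by (simp add: A_def)
  note Mi = mat_inv[OF M invM]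
  note Ai = mat_inv[OF A invA[folded A_def]]
  show B: "B \<in> carrier_mat n n" using Mi K by (simp add: B_def)
  show BA: "B = mat_inv M * A"
    using Mi M K by (simp add: A_def B_def mult_add_distrib_mat)
  show MiB: "mat_inv M = B * mat_inv A"
    unfolding BA using assoc_mult_mat[OF Mi(1) A Ai(1)] Ai Mi by simp
  have "B * (mat_inv A * M) = 1\<^sub>m n"
    using assoc_mult_mat[OF B Ai(1) M] Mi MiB by simp
  moreover have "(mat_inv A * M) * B = 1\<^sub>m n"
  proof -
    have "(mat_inv A * M) * B = mat_inv A * (M * (mat_inv M * A))"
      unfolding BA using Ai Mi M A by (intro assoc_mult_mat) auto
    also have "M * (mat_inv M * A) = A"
      using assoc_mult_mat[OF M Mi(1) A] Mi A by simp
    finally show ?thesis using Ai by simp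
  qed
  ultimately show "invertible_mat B"
    using B Ai M unfolding invertible_mat_def inverts_mat_def by auto
qed

text \<open>
  The lower bound on \<open>\<parallel>B\<parallel>\<close> that compensates for the summand \<open>1\<close> in the residual bound, for one
  vector \<open>v\<close> at a time: write \<open>v = B v - M\<inverse> K v\<close> and use \<open>\<parallel>M\<inverse>\<parallel> \<le> \<parallel>B\<parallel> \<parallel>A\<inverse>\<parallel>\<close>.
\<close>

lemma norm_le_preconditioned:
  fixes M K :: "real mat"
  assumes N: "is_vec_norm n N" and M: "M \<in> carrier_mat n n" and K: "K \<in> carrier_mat n n"
    and invA: "invertible_mat (M + K)" and invM: "invertible_mat M" and v: "v \<in> carrier_vec n"
  defines "A \<equiv> M + K" and "B \<equiv> 1\<^sub>m n + mat_inv M * K"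
  shows "N v \<le> op_norm n N B * (N v + op_norm n N (mat_inv A) * (op_norm n N K * N v))"
    and "op_norm n N (mat_inv M) \<le> op_norm n N B * op_norm n N (mat_inv A)"
proof -
  have A: "A \<in> carrier_mat n n" using M K by (simp add: A_def)
  note Mi = mat_inv[OF M invM]
  note Ai = mat_inv[OF A invA[folded A_def]]
  note B = preconditioned_carrier[OF M K invA invM, folded B_def]
  show Mi_le: "op_norm n N (mat_inv M) \<le> op_norm n N B * op_norm n N (mat_inv A)"
    using op_norm_mult_le[OF N B Ai(1)] preconditioned_mult_inv[OF M K invA invM]
    by (simp add: A_def B_def)
  define w where "w = mat_inv M *\<^sub>v (K *\<^sub>v v)"
  have w: "w \<in> carrier_vec n" using Mi K v by (simp add: w_def)
  have "B *\<^sub>v v = v + w"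
    using Mi K v unfolding B_def w_def
    by (simp add: add_mult_distrib_mat_vec[of _ n n] assoc_mult_mat_vec[of _ n n _ n])
  then have "v = B *\<^sub>v v + (-1) \<cdot>\<^sub>v w"
    using v w by (intro eq_vecI) auto
  then have "N v \<le> N (B *\<^sub>v v) + N ((-1) \<cdot>\<^sub>v w)"
    using is_vec_norm_triangle[OF N, of "B *\<^sub>v v" "(-1) \<cdot>\<^sub>v w"] B v w by simp
  also have "N ((-1) \<cdot>\<^sub>v w) = N w"
    using is_vec_norm_smult[OF N w, of "-1"] by simp
  also have "N w \<le> op_norm n N (mat_inv M) * N (K *\<^sub>v v)"
    unfolding w_def using K v by (intro norm_mult_mat_vec_le[OF N Mi(1)]) simp
  also have "\<dots> \<le> (op_norm n N B * op_norm n N (mat_inv A)) * (op_norm n N K * N v)"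
    using K v Mi_le op_norm_nonneg[OF N B] op_norm_nonneg[OF N Ai(1)]
    by (intro mult_mono norm_mult_mat_vec_le[OF N K v] is_vec_norm_nonneg[OF N]) auto
  finally show "N v \<le> op_norm n N B * (N v + op_norm n N (mat_inv A) * (op_norm n N K * N v))"
    using norm_mult_mat_vec_le[OF N B v] by (simp add: algebra_simps)
qed

lemma norm_le_of_residual_le:
  assumes N: "is_vec_norm n N" and A: "A \<in> carrier_mat n n" and invA: "invertible_mat A"
    and b: "b \<in> carrier_vec n" and y: "y \<in> carrier_vec n" and res: "N (b - A *\<^sub>v y) \<le> N b"
  shows "N y \<le> 2 * op_norm n N (mat_inv A) * N b"
proof -
  note Ai = mat_inv[OF A invA]
  have Ay: "A *\<^sub>v y \<in> carrier_vec n" using A y by simp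
  have "A *\<^sub>v y = b + (A *\<^sub>v y - b)"
    using b Ay by (intro eq_vecI) (auto dest: carrier_vecD)
  then have "N (A *\<^sub>v y) \<le> N b + N (A *\<^sub>v y - b)"
    using is_vec_norm_triangle[OF N b, of "A *\<^sub>v y - b"] b Ay by simp
  then have Ay_le: "N (A *\<^sub>v y) \<le> 2 * N b"
    using res is_vec_norm_minus_commute[OF N b Ay] by simp
  have "y = mat_inv A *\<^sub>v (A *\<^sub>v y)"
    using assoc_mult_mat_vec[OF Ai(1) A y] Ai y by simp
  then have "N y \<le> op_norm n N (mat_inv A) * N (A *\<^sub>v y)"
    using norm_mult_mat_vec_le[OF N Ai(1) Ay] by simp
  also have "\<dots> \<le> op_norm n N (mat_inv A) * (2 * N b)"
    using Ay_le op_norm_nonneg[OF N Ai(1)] by (rule mult_left_mono)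
  finally show ?thesis by simp
qed

lemma norm_error_le_residual:
  assumes N: "is_vec_norm n N" and B: "B \<in> carrier_mat n n" and invB: "invertible_mat B"
    and x: "x \<in> carrier_vec n" and y: "y \<in> carrier_vec n"
  shows "N (x - y) \<le> op_norm n N (mat_inv B) * N (B *\<^sub>v x - B *\<^sub>v y)"
proof -
  note Bi = mat_inv[OF B invB]
  have "mat_inv B *\<^sub>v (B *\<^sub>v (x - y)) = x - y"
    using assoc_mult_mat_vec[OF Bi(1) B, of "x - y"] Bi x y by simp
  moreover have "B *\<^sub>v (x - y) = B *\<^sub>v x - B *\<^sub>v y"
    by (rule mult_minus_distrib_mat_vec[OF B x y])
  moreover have "N (mat_inv B *\<^sub>v (B *\<^sub>v (x - y)))
      \<le> op_norm n N (mat_inv B) * N (B *\<^sub>v (x - y))"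
    using B x y by (intro norm_mult_mat_vec_le[OF N Bi(1)]) simp
  ultimately show ?thesis by simp
qed

theorem theorem4:
  fixes p :: "real poly"
  shows "\<exists>q r :: real poly.
    \<forall>(n :: nat) (N :: real vec \<Rightarrow> real) (u :: real)
      (A :: real mat) (M :: real mat) (K :: real mat) (B :: real mat)
      (b :: real vec) (c :: real vec) (x :: real vec) (x\<^sub>L :: real vec).
      is_vec_norm n N \<longrightarrow>
      0 < u \<longrightarrow> u < 1 \<longrightarrow>
      M \<in> carrier_mat n n \<longrightarrow> K \<in> carrier_mat n n \<longrightarrow> A = M + K \<longrightarrow>
      invertible_mat A \<longrightarrow> invertible_mat M \<longrightarrow>
      b \<in> carrier_vec n \<longrightarrow> b \<noteq> 0\<^sub>v n \<longrightarrow>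
      x = mat_inv A *\<^sub>v b \<longrightarrow>
      B = 1\<^sub>m n + mat_inv M * K \<longrightarrow>
      c = mat_inv M *\<^sub>v b \<longrightarrow>
      x\<^sub>L \<in> carrier_vec n \<longrightarrow>
      N (c - B *\<^sub>v x\<^sub>L)
        \<le> poly p (real n) * u * (1 + op_norm n N (mat_inv M) * op_norm n N K) * N x\<^sub>L \<longrightarrow>
      N (b - A *\<^sub>v x\<^sub>L) \<le> N b \<longrightarrow>
      N (x - x\<^sub>L) / (op_norm n N (mat_inv A) * N b)
        \<le> poly q (real n) * u * cond_num n N B * (1 + op_norm n N K * N x\<^sub>L / N b) \<and>
      poly q (real n) * u * cond_num n N B * (1 + op_norm n N K * N x\<^sub>L / N b)
        \<le> poly r (real n) * u * cond_num n N B * (1 + 2 * op_norm n N (mat_inv A) * op_norm n N K)"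
proof (rule exI[of _ "p * p + 1"], rule exI[of _ "p * p + 1"], intro allI impI)
  fix n :: nat and N :: "real vec \<Rightarrow> real" and u :: real and A M K B :: "real mat"
    and b c x x\<^sub>L :: "real vec"
  assume N: "is_vec_norm n N" and u: "0 < u" and M: "M \<in> carrier_mat n n"
    and K: "K \<in> carrier_mat n n" and A_eq: "A = M + K" and invA: "invertible_mat A"
    and invM: "invertible_mat M" and b: "b \<in> carrier_vec n" and b0: "b \<noteq> 0\<^sub>v n"
    and x_eq: "x = mat_inv A *\<^sub>v b" and B_eq: "B = 1\<^sub>m n + mat_inv M * K"
    and c_eq: "c = mat_inv M *\<^sub>v b" and xL: "x\<^sub>L \<in> carrier_vec n"
    and res_B: "N (c - B *\<^sub>v x\<^sub>L)
        \<le> poly p (real n) * u * (1 + op_norm n N (mat_inv M) * op_norm n N K) * N x\<^sub>L"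
    and res_A: "N (b - A *\<^sub>v x\<^sub>L) \<le> N b"
  have A: "A \<in> carrier_mat n n" using M K by (simp add: A_eq)
  note invMK = invA[unfolded A_eq]
  note Ai = mat_inv[OF A invA] and Mi = mat_inv[OF M invM]
  note B = preconditioned_carrier[OF M K invMK invM, folded B_eq]
  note invB = preconditioned_invertible[OF M K invMK invM, folded B_eq]
  note Bi = mat_inv[OF B invB]
  have x: "x \<in> carrier_vec n" using Ai b by (simp add: x_eq)
  have c: "c = B *\<^sub>v x"
    using preconditioned_mult_inv[OF M K invMK invM, folded A_eq B_eq]
      assoc_mult_mat_vec[OF B Ai(1) b] by (simp add: c_eq x_eq)
  define \<alpha> \<beta> \<gamma> \<kappa> \<mu> where "\<alpha> = op_norm n N (mat_inv A)" and "\<beta> = op_norm n N B"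
    and "\<gamma> = op_norm n N (mat_inv B)" and "\<kappa> = op_norm n N K" and "\<mu> = op_norm n N (mat_inv M)"
  note defs = \<alpha>_def \<beta>_def \<gamma>_def \<kappa>_def \<mu>_def
  define P Q where "P = \<bar>poly p (real n)\<bar>" and "Q = poly (p * p + 1) (real n)"
  have nonneg: "0 \<le> \<alpha>" "0 \<le> \<beta>" "0 \<le> \<gamma>" "0 \<le> \<kappa>" "0 \<le> \<mu>" "0 \<le> P"
    unfolding defs P_def using op_norm_nonneg[OF N] Ai Mi Bi B K by auto
  have PQ: "2 * P \<le> Q"
    using zero_le_power2[of "P - 1"] by (simp add: P_def Q_def power2_eq_square algebra_simps)
  have Nb: "0 < N b"
    using is_vec_norm_nonneg[OF N b] is_vec_norm_eq_0_iff[OF N b] b0 by simp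
  have NxL: "0 \<le> N x\<^sub>L"
    using is_vec_norm_nonneg[OF N xL] .
  have xL_le: "N x\<^sub>L \<le> 2 * \<alpha> * N b"
    unfolding defs by (rule norm_le_of_residual_le[OF N A invA b xL res_A])
  have \<alpha>: "0 < \<alpha>"
  proof -
    have "A *\<^sub>v x = b"
      using assoc_mult_mat_vec[OF A Ai(1) b] Ai b by (simp add: x_eq)
    then have "0 < N x"
      using A b0 is_vec_norm_nonneg[OF N x] is_vec_norm_eq_0_iff[OF N x] by (force simp: less_le)
    moreover have "N x \<le> \<alpha> * N b"
      unfolding defs x_eq by (rule norm_mult_mat_vec_le[OF N Ai(1) b])
    ultimately show ?thesis
      using nonneg(1) by (cases "\<alpha> = 0") auto
  qed
  note pre = norm_le_preconditioned[OF N M K invMK invM xL, folded A_eq B_eq, folded defs]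
  \<comment> \<open>The factor 2 on the right arises twice: from \<open>N x\<^sub>L \<le> 2 * \<alpha> * N b\<close>, and because the summand
    \<open>N x\<^sub>L\<close> and the summand with \<open>\<mu>\<close> each contribute one copy of \<open>\<beta> * (\<alpha> * (\<kappa> * N x\<^sub>L))\<close>.\<close>
  have "(1 + \<mu> * \<kappa>) * N x\<^sub>L \<le> \<beta> * (N x\<^sub>L + \<alpha> * (\<kappa> * N x\<^sub>L)) + (\<beta> * \<alpha>) * (\<kappa> * N x\<^sub>L)"
    using pre(1) mult_right_mono[OF pre(2), of "\<kappa> * N x\<^sub>L"] nonneg NxL by (simp add: algebra_simps)
  also have "\<dots> \<le> \<beta> * (2 * \<alpha> * N b + \<alpha> * (\<kappa> * N x\<^sub>L)) + (\<beta> * \<alpha>) * (\<kappa> * N x\<^sub>L)"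
    using xL_le nonneg by (intro add_right_mono mult_left_mono) auto
  also have "\<dots> = 2 * \<beta> * \<alpha> * N b * (1 + \<kappa> * N x\<^sub>L / N b)"
    using Nb by (simp add: field_simps)
  finally have key: "(1 + \<mu> * \<kappa>) * N x\<^sub>L \<le> 2 * \<beta> * \<alpha> * N b * (1 + \<kappa> * N x\<^sub>L / N b)" .
  have E: "0 \<le> 1 + \<kappa> * N x\<^sub>L / N b"
    using nonneg NxL Nb by simp
  have "N (x - x\<^sub>L) \<le> \<gamma> * N (c - B *\<^sub>v x\<^sub>L)"
    unfolding defs c by (rule norm_error_le_residual[OF N B invB x xL])
  also have "\<dots> \<le> \<gamma> * (poly p (real n) * u * ((1 + \<mu> * \<kappa>) * N x\<^sub>L))"
    using res_B nonneg by (intro mult_left_mono) (simp_all add: defs mult.assoc)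
  also have "\<dots> \<le> \<gamma> * (P * u * ((1 + \<mu> * \<kappa>) * N x\<^sub>L))"
    using nonneg u NxL by (intro mult_left_mono mult_right_mono) (auto simp: P_def)
  also have "\<dots> \<le> \<gamma> * (P * u * (2 * \<beta> * \<alpha> * N b * (1 + \<kappa> * N x\<^sub>L / N b)))"
    using nonneg u key by (intro mult_left_mono) auto
  also have "\<dots> = 2 * P * (u * (\<beta> * \<gamma>) * (1 + \<kappa> * N x\<^sub>L / N b) * (\<alpha> * N b))"
    by (simp only: mult_ac)
  also have "\<dots> \<le> Q * (u * (\<beta> * \<gamma>) * (1 + \<kappa> * N x\<^sub>L / N b) * (\<alpha> * N b))"
    using PQ u nonneg E Nb by (intro mult_right_mono mult_nonneg_nonneg) auto
  finally have "N (x - x\<^sub>L) / (\<alpha> * N b) \<le> Q * u * (\<beta> * \<gamma>) * (1 + \<kappa> * N x\<^sub>L / N b)"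
    using \<alpha> Nb by (simp add: pos_divide_le_eq mult.assoc)
  moreover have "Q * u * (\<beta> * \<gamma>) * (1 + \<kappa> * N x\<^sub>L / N b) \<le> Q * u * (\<beta> * \<gamma>) * (1 + 2 * \<alpha> * \<kappa>)"
  proof (rule mult_left_mono)
    have "\<kappa> * N x\<^sub>L \<le> \<kappa> * (2 * \<alpha> * N b)"
      using xL_le nonneg(4) by (rule mult_left_mono)
    then show "1 + \<kappa> * N x\<^sub>L / N b \<le> 1 + 2 * \<alpha> * \<kappa>"
      using Nb by (simp add: pos_divide_le_eq mult_ac)
    show "0 \<le> Q * u * (\<beta> * \<gamma>)"
      using PQ u nonneg by (intro mult_nonneg_nonneg) auto
  qed
  ultimately show "N (x - x\<^sub>L) / (op_norm n N (mat_inv A) * N b)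
        \<le> poly (p * p + 1) (real n) * u * cond_num n N B * (1 + op_norm n N K * N x\<^sub>L / N b) \<and>
      poly (p * p + 1) (real n) * u * cond_num n N B * (1 + op_norm n N K * N x\<^sub>L / N b)
        \<le> poly (p * p + 1) (real n) * u * cond_num n N B
            * (1 + 2 * op_norm n N (mat_inv A) * op_norm n N K)"
    unfolding cond_num_def defs Q_def by blast
qed

end
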